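(* Let $K\subseteq\mathbb{R}^k$ be a nontrivial pointed closed convex cone, and let $L\in\mathbb{R}^{k\times n}$, $A\in\mathbb{R}^{m\times n}$, $b\in\mathbb{R}^m$. Let $$\mathcal{B}=\{(\lambda,U,v)\in K^{*0}\times\mathbb{R}^{k\times m}\times\mathbb{R}^k : \lambda^Tv=0 \text{ and } (L-UA)^T\lambda\in\mathbb{R}^n_+\},\qquad h(\lambda,U,v)=Ub+v,$$ $$\mathcal{B}^L=\{(\lambda,z,v)\in K^{*0}\times\mathbb{R}^m\times\mathbb{R}^k : \lambda^Tv-z^Tb\leq 0 \text{ and } L^T\lambda-A^Tz\in\mathbb{R}^n_+\},\qquad h^L(\lambda,z,v)=v.$$ Then $h(\mathcal{B})\subseteq h^L(\mathcal{B}^L)$.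
   Context: $\mathbb{R}^n_+$ denotes the nonnegative orthant. A set $K\subseteq\mathbb{R}^k$ is a cone if $\lambda K\subseteq K$ for all $\lambda\geq 0$; it is nontrivial if $K\neq\{0\}$ and $K\neq\mathbb{R}^k$, and pointed if $K\cap(-K)=\{0\}$. Set $K^{*0}=\{\lambda\in\mathbb{R}^k:\lambda^Tv>0\ \forall v\in K\setminus\{0\}\}$. *)

theory Defs
  imports "HOL-Analysis.Analysis"
begin

text \<open>A real matrix with \<open>k\<close> rows and \<open>n\<close> columns has type \<^typ>\<open>real ^ 'n ^ 'k\<close>. Cones are taken
  in the sense of \<^const>\<open>cone\<close> (closed under scaling by all nonnegative reals).\<close>

definition nonneg_orthant :: "(real ^ 'n) set" where
  "nonneg_orthant = {x. \<forall>i. 0 \<le> x $ i}"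

definition nontrivial :: "(real ^ 'k) set \<Rightarrow> bool" where
  "nontrivial K \<longleftrightarrow> K \<noteq> {0} \<and> K \<noteq> UNIV"

text \<open>The empty set satisfies \<^const>\<open>cone\<close> and \<open>nontrivial\<close>, but it is not pointed.\<close>

definition pointed :: "(real ^ 'k) set \<Rightarrow> bool" where
  "pointed K \<longleftrightarrow> K \<inter> uminus ` K = {0}"

definition strict_dual :: "(real ^ 'k) set \<Rightarrow> (real ^ 'k) set" where
  "strict_dual K = {l. \<forall>v \<in> K - {0}. 0 < l \<bullet> v}"

definition feasible_B ::
  "(real ^ 'k) set \<Rightarrow> real ^ 'n ^ 'k \<Rightarrow> real ^ 'n ^ 'm
    \<Rightarrow> ((real ^ 'k) \<times> (real ^ 'm ^ 'k) \<times> (real ^ 'k)) set" where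
  "feasible_B K L A =
     {(l, U, v). l \<in> strict_dual K \<and> l \<bullet> v = 0 \<and>
        transpose (L - U ** A) *v l \<in> nonneg_orthant}"

definition objective_h ::
  "real ^ 'm \<Rightarrow> (real ^ 'k) \<times> (real ^ 'm ^ 'k) \<times> (real ^ 'k) \<Rightarrow> real ^ 'k" where
  "objective_h b = (\<lambda>(l, U, v). U *v b + v)"

definition feasible_BL ::
  "(real ^ 'k) set \<Rightarrow> real ^ 'n ^ 'k \<Rightarrow> real ^ 'n ^ 'm \<Rightarrow> real ^ 'm
    \<Rightarrow> ((real ^ 'k) \<times> (real ^ 'm) \<times> (real ^ 'k)) set" where
  "feasible_BL K L A b =
     {(l, z, v). l \<in> strict_dual K \<and> l \<bullet> v - z \<bullet> b \<le> 0 \<and>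
        transpose L *v l - transpose A *v z \<in> nonneg_orthant}"

definition objective_hL :: "(real ^ 'k) \<times> (real ^ 'm) \<times> (real ^ 'k) \<Rightarrow> real ^ 'k" where
  "objective_hL = (\<lambda>(l, z, v). v)"

end

theory Submission
  imports Defs
begin

text \<open>Send (\<open>l\<close>, \<open>U\<close>, \<open>v\<close>) to (\<open>l\<close>,
  \<open>z\<close>, \<open>y\<close>) with \<open>z\<close> = U^T l and \<open>y\<close> = Ub + v,
  which keeps the objective value. Since z^T b = l^T U b, the scalar constraint becomes l^T y - z^T
  b = l^T v = 0; and L^T l - A^T z = (L - UA)^T l, so the orthant constraint is the same
  vector.\<close>

theorem theorem9:
  fixes K :: "(real ^ 'k) set"
    and L :: "real ^ 'n ^ 'k"
    and A :: "real ^ 'n ^ 'm"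
    and b :: "real ^ 'm"
  assumes "cone K" and "convex K" and "closed K"
    and "nontrivial K" and "pointed K"
  shows "objective_h b ` feasible_B K L A \<subseteq> objective_hL ` feasible_BL K L A b"
proof
  fix y
  assume "y \<in> objective_h b ` feasible_B K L A"
  then obtain l U v where y: "y = U *v b + v" and l: "l \<in> strict_dual K"
    and lv: "l \<bullet> v = 0" and nonneg: "transpose (L - U ** A) *v l \<in> nonneg_orthant"
    by (auto simp: objective_h_def feasible_B_def)
  define z where "z = transpose U *v l"
  have "z \<bullet> b = l \<bullet> (U *v b)"
    \<comment> \<open>Adjointness, with U^T l read as the row-vector product
      \<open>l v* U\<close>.\<close>
    by (simp add: z_def dot_lmul_matrix transpose_matrix_vector)
  with lv have "l \<bullet> y - z \<bullet> b \<le> 0"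
    by (simp add: y inner_add_right)
  moreover have "transpose (L - U ** A) = transpose L - transpose A ** transpose U"
    \<comment> \<open>Folding the product into (UA)^T leaves additivity of transposition, checked
      entrywise.\<close>
    by (simp add: matrix_transpose_mul[symmetric]) (simp add: transpose_def vec_eq_iff)
  with nonneg have "transpose L *v l - transpose A *v z \<in> nonneg_orthant"
    by (simp only: z_def matrix_vector_mul_assoc matrix_vector_mult_diff_rdistrib)
  ultimately have "(l, z, y) \<in> feasible_BL K L A b"
    using l by (simp add: feasible_BL_def)
  then show "y \<in> objective_hL ` feasible_BL K L A b"
    by (force simp: objective_hL_def)
qed

end
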